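(* Let $V_1,V_2,V_3,V_4$, $p_1,p_2,p_3,p_4$ be the data of a string segment in $AdS_3$ satisfying the causality conditions (see context), with world sheet area $A_\diamond$. For $i\ne j$ let $$S(ij)=\frac{c}{6}\log\frac{|a_i-a_j|}{\delta}+\frac{c}{6}\log\frac{|\bar a_i-\bar a_j|}{\delta},\qquad c=\frac{3L}{2G},$$ be the entanglement entropy of the boundary subsystem whose causal diamond has as its past and future tips the boundary points with light cone coordinates $(a_i,\bar a_i)$ and $(a_j,\bar a_j)$. Then $$\frac{A_\diamond}{4GL}=S(14)+S(23)-S(34)-S(12).$$
   Context: $\mathbb{R}^{2,2}$ has coordinates $X^{-1},X^0,X^1,X^2$ and bilinear form $X\cdot Y=-X^{-1}Y^{-1}-X^0Y^0+X^1Y^1+X^2Y^2$; $X^\pm=X^1\pm X^{-1}$. $AdS_3=\{X: X\cdot X=-L^2\}$ with $L>0$. A string segment is given by $V_1\in AdS_3$ and null vectors $p_1,p_4\in\mathbb{R}^{2,2}$ with $p_1\cdot V_1=p_4\cdot V_1=0$. Its world sheet is the image of $$X(\sigma^-,\sigma^+)=\frac{L^2+\sigma^-\sigma^+\frac12 p_1\cdot p_4}{L^2-\sigma^-\sigma^+\frac12 p_1\cdot p_4}V_1+L^2\frac{\sigma^-p_1+\sigma^+p_4}{L^2-\sigma^-\sigma^+\frac12 p_1\cdot p_4},\qquad \sigma^\pm\in[0,1],$$ with vertices $V_2=X(1,0)=V_1+p_1$, $V_4=X(0,1)=V_1+p_4$, $V_3=X(1,1)$, and $p_2=V_3-V_2$,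 $p_3=V_3-V_4$. $A_\diamond=\int_0^1\int_0^1\sqrt{-\det(\partial_\alpha X\cdot\partial_\beta X)}\,d\sigma^-d\sigma^+$ is its Lorentzian area. Boundary points (assuming $p_i^-\neq0$): $x_i=(t_i,x_i^1)=\frac{L}{p_i^-}(p_i^0,p_i^2)\in\mathbb{R}^{1,1}$, where $\mathbb{R}^{1,1}$ has product $x\bullet y=-x^0y^0+x^1y^1$. Their light cone coordinates are $a_i=t_i+x_i^1$, $\bar a_i=t_i-x_i^1$. Causality conditions: $V_i^->0$ for all $i$; $p_1\cdot p_4<0$; $(x_i-x_j)\bullet(x_i-x_j)<0$ for the neighbouring edges $(ij)=(12),(23),(34),(14)$; and $t_1<t_3<t_4<t_2$. $G>0$ is the three-dimensional Newton constant and $\delta>0$ is a UV cutoff. *)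

theory Defs
  imports "HOL-Analysis.Analysis"
begin

section \<open>The ambient space with signature (2,2)\<close>

text \<open>
  Vectors of \<open>\<real>\<^sup>2\<^sup>,\<^sup>2\<close> have type \<open>real^4\<close>, with the four components indexed by
  \<open>-1, 0, 1, 2\<close>.  Numerals in the index type \<open>4\<close> are taken modulo 4, so these are four
  distinct indices and exhaust the type; the next lemma confirms this.
\<close>

lemma R22_indices: "(UNIV :: 4 set) = {-1, 0, 1, 2}" "distinct [-1, 0, 1, 2 :: 4]"
proof -
  have neg: "-1 = (3::4)" and zero: "4 = (0::4)" by simp_all
  show "(UNIV :: 4 set) = {-1, 0, 1, 2}" unfolding UNIV_4 neg zero by blast
  show "distinct [-1, 0, 1, 2 :: 4]" unfolding neg by simp
qed

definition mdot :: "real^4 \<Rightarrow> real^4 \<Rightarrow> real"  (infixl "\<odot>" 70)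
  where "X \<odot> Y = - (X $ (-1)) * (Y $ (-1)) - (X $ 0) * (Y $ 0) + (X $ 1) * (Y $ 1) + (X $ 2) * (Y $ 2)"

definition minus_comp :: "real^4 \<Rightarrow> real"
  where "minus_comp X = X $ 1 - X $ (-1)"

definition null_vector :: "real^4 \<Rightarrow> bool"
  where "null_vector p \<longleftrightarrow> p \<odot> p = 0"

definition AdS3 :: "real \<Rightarrow> (real^4) set"
  where "AdS3 L = {X. X \<odot> X = - L\<^sup>2}"

section \<open>String segments\<close>

definition world_sheet :: "real \<Rightarrow> real^4 \<Rightarrow> real^4 \<Rightarrow> real^4 \<Rightarrow> real \<Rightarrow> real \<Rightarrow> real^4"
  where "world_sheet L V\<^sub>1 p\<^sub>1 p\<^sub>4 s\<^sub>m s\<^sub>p =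
    ((L\<^sup>2 + s\<^sub>m * s\<^sub>p * (1/2) * (p\<^sub>1 \<odot> p\<^sub>4)) / (L\<^sup>2 - s\<^sub>m * s\<^sub>p * (1/2) * (p\<^sub>1 \<odot> p\<^sub>4))) *\<^sub>R V\<^sub>1
    + (L\<^sup>2 / (L\<^sup>2 - s\<^sub>m * s\<^sub>p * (1/2) * (p\<^sub>1 \<odot> p\<^sub>4))) *\<^sub>R (s\<^sub>m *\<^sub>R p\<^sub>1 + s\<^sub>p *\<^sub>R p\<^sub>4)"

text \<open>
  The vertices \<open>V i\<close> and edges \<open>p i\<close> are relevant for \<open>i = 1, 2, 3, 4\<close> only; the values at
  other indices are unconstrained.
\<close>

definition string_segment :: "real \<Rightarrow> (nat \<Rightarrow> real^4) \<Rightarrow> (nat \<Rightarrow> real^4) \<Rightarrow> bool"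
  where "string_segment L V p \<longleftrightarrow>
    V 1 \<in> AdS3 L \<and> null_vector (p 1) \<and> null_vector (p 4) \<and>
    p 1 \<odot> V 1 = 0 \<and> p 4 \<odot> V 1 = 0 \<and>
    V 2 = world_sheet L (V 1) (p 1) (p 4) 1 0 \<and>
    V 4 = world_sheet L (V 1) (p 1) (p 4) 0 1 \<and>
    V 3 = world_sheet L (V 1) (p 1) (p 4) 1 1 \<and>
    p 2 = V 3 - V 2 \<and> p 3 = V 3 - V 4"

lemma string_segment_vertices:
  assumes "string_segment L V p" and "L > 0"
  shows "V 2 = V 1 + p 1" and "V 4 = V 1 + p 4"
  using assms by (simp_all add: string_segment_def world_sheet_def)

definition induced_metric :: "(real \<Rightarrow> real \<Rightarrow> real^4) \<Rightarrow> real \<Rightarrow> real \<Rightarrow> real^2^2"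
  where "induced_metric X s\<^sub>m s\<^sub>p =
    (let X\<^sub>m = vector_derivative (\<lambda>s. X s s\<^sub>p) (at s\<^sub>m);
         X\<^sub>p = vector_derivative (\<lambda>s. X s\<^sub>m s) (at s\<^sub>p)
     in vector [vector [X\<^sub>m \<odot> X\<^sub>m, X\<^sub>m \<odot> X\<^sub>p], vector [X\<^sub>p \<odot> X\<^sub>m, X\<^sub>p \<odot> X\<^sub>p]])"

definition lorentzian_area :: "(real \<Rightarrow> real \<Rightarrow> real^4) \<Rightarrow> real"
  where "lorentzian_area X =
    integral {0..1} (\<lambda>s\<^sub>p. integral {0..1} (\<lambda>s\<^sub>m. sqrt (- det (induced_metric X s\<^sub>m s\<^sub>p))))"

definition segment_area :: "real \<Rightarrow> (nat \<Rightarrow> real^4) \<Rightarrow> (nat \<Rightarrow> real^4) \<Rightarrow> real"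
  where "segment_area L V p = lorentzian_area (world_sheet L (V 1) (p 1) (p 4))"

section \<open>Boundary points\<close>

text \<open>Points of \<open>\<real>\<^sup>1\<^sup>,\<^sup>1\<close> are pairs (time, space).\<close>

definition bdot :: "real \<times> real \<Rightarrow> real \<times> real \<Rightarrow> real"
  where "bdot x y = - fst x * fst y + snd x * snd y"

definition boundary_point :: "real \<Rightarrow> real^4 \<Rightarrow> real \<times> real"
  where "boundary_point L p = (L / minus_comp p) *\<^sub>R (p $ 0, p $ 2)"

definition lc :: "real \<times> real \<Rightarrow> real"
  where "lc x = fst x + snd x"

definition lc_bar :: "real \<times> real \<Rightarrow> real"
  where "lc_bar x = fst x - snd x"

definition causality_conditions :: "real \<Rightarrow> (nat \<Rightarrow> real^4) \<Rightarrow> (nat \<Rightarrow> real^4) \<Rightarrow> bool"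
  where "causality_conditions L V p \<longleftrightarrow>
    (let x = (\<lambda>i. boundary_point L (p i)); t = (\<lambda>i. fst (x i)) in
      (\<forall>i\<in>{1..4}. minus_comp (V i) > 0) \<and>
      p 1 \<odot> p 4 < 0 \<and>
      (\<forall>(i, j)\<in>{(1, 2), (2, 3), (3, 4), (1, 4)}. bdot (x i - x j) (x i - x j) < 0) \<and>
      t 1 < t 3 \<and> t 3 < t 4 \<and> t 4 < t 2)"

section \<open>Entanglement entropy\<close>

definition central_charge :: "real \<Rightarrow> real \<Rightarrow> real"
  where "central_charge L G = 3 * L / (2 * G)"

text \<open>
  Entropy of the subsystem whose causal diamond has tips \<open>x\<close> and \<open>y\<close>, with UV cutoff
  \<open>\<delta>\<close>.  It is symmetric in the tips, so which one is the past tip need not be recorded.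
\<close>

definition entanglement_entropy :: "real \<Rightarrow> real \<Rightarrow> real \<times> real \<Rightarrow> real \<times> real \<Rightarrow> real"
  where "entanglement_entropy c \<delta> x y =
    c / 6 * ln (\<bar>lc x - lc y\<bar> / \<delta>) + c / 6 * ln (\<bar>lc_bar x - lc_bar y\<bar> / \<delta>)"

definition segment_entropy :: "real \<Rightarrow> real \<Rightarrow> real \<Rightarrow> (nat \<Rightarrow> real^4) \<Rightarrow> nat \<Rightarrow> nat \<Rightarrow> real"
  where "segment_entropy L G \<delta> p i j =
    entanglement_entropy (central_charge L G) \<delta> (boundary_point L (p i)) (boundary_point L (p j))"

end

(* In terms of h = - (p1 . p4) / 2 > 0, the light-like coordinates are conformal with
   X_- . X_+ = - 2 h L^4 / (L^2 + h s_m s_p)^2, so the area integrates to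
   2 L^2 ln ((L^2 + h) / L^2).  On the boundary, (x_i - x_j)^2 = - 2 L^2 (p_i . p_j) / (p_i^- p_j^-)
   for null p_i, p_j, so the entropies combine into the logarithm of the cross ratio
   (p1 . p4) (p2 . p3) / ((p3 . p4) (p1 . p2)), in which the p_i^- cancel.  The edge equations give
   p2 . p3 = p1 . p4 and p1 . p2 = p3 . p4 = L^2 (p1 . p4) / (L^2 + h), so the cross ratio is
   ((L^2 + h) / L^2)^2. *)
theory Submission
  imports Defs
begin

lemma mdot_commute: "X \<odot> Y = Y \<odot> X"
  by (simp add: mdot_def algebra_simps)

lemma mdot_add_left: "(X + Y) \<odot> Z = X \<odot> Z + Y \<odot> Z"
  by (simp add: mdot_def algebra_simps)

lemma mdot_scaleR_left: "(a *\<^sub>R X) \<odot> Z = a * (X \<odot> Z)"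
  by (simp add: mdot_def algebra_simps)

lemma mdot_add_right: "Z \<odot> (X + Y) = Z \<odot> X + Z \<odot> Y"
  by (simp add: mdot_def algebra_simps)

lemma mdot_scaleR_right: "Z \<odot> (a *\<^sub>R X) = a * (Z \<odot> X)"
  by (simp add: mdot_def algebra_simps)

lemmas mdot_bilinear = mdot_add_left mdot_add_right mdot_scaleR_left mdot_scaleR_right

text \<open>The tangent vectors of the world sheet and all four edges lie in the span of
  \<open>V\<close>, \<open>p\<close>, \<open>q\<close>, so this Gram form turns each later product
  into arithmetic with coefficients. The normalisation \<open>- 2 * h\<close> turns the denominator
  of the world sheet into \<open>L\<^sup>2 + h * u * v\<close>.\<close>

lemma mdot_frame:
  assumes "V \<odot> V = - L\<^sup>2" "p \<odot> p = 0" "q \<odot> q = 0" "p \<odot> V = 0" "q \<odot> V = 0" "p \<odot> q = - 2 * h"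
  shows "(a *\<^sub>R V + b *\<^sub>R p + c *\<^sub>R q) \<odot> (a' *\<^sub>R V + b' *\<^sub>R p + c' *\<^sub>R q)
    = - L\<^sup>2 * (a * a') - 2 * h * (b * c' + c * b')"
  using assms mdot_commute[of V p] mdot_commute[of V q] mdot_commute[of q p]
  by (simp add: mdot_bilinear algebra_simps)

text \<open>With this symmetry, one derivative formula serves both parameters.\<close>

lemma world_sheet_swap: "world_sheet L V p q u v = world_sheet L V q p v u"
  by (simp add: world_sheet_def mdot_commute[of q p] algebra_simps)

lemma world_sheet_frame:
  assumes "p \<odot> q = - 2 * h"
  shows "world_sheet L V p q u v =
    ((L\<^sup>2 - h * u * v) / (L\<^sup>2 + h * u * v)) *\<^sub>R V
    + (L\<^sup>2 * u / (L\<^sup>2 + h * u * v)) *\<^sub>R p + (L\<^sup>2 * v / (L\<^sup>2 + h * u * v)) *\<^sub>R q"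
  using assms by (simp add: world_sheet_def algebra_simps)

lemma has_vector_derivative_world_sheet:
  assumes k: "p \<odot> q = - 2 * h" and D: "L\<^sup>2 + h * u * v \<noteq> 0"
  shows "((\<lambda>u. world_sheet L V p q u v) has_vector_derivative
    (- 2 * h * v * L\<^sup>2 / (L\<^sup>2 + h * u * v)\<^sup>2) *\<^sub>R V + (L^4 / (L\<^sup>2 + h * u * v)\<^sup>2) *\<^sub>R p
    + (- h * v\<^sup>2 * L\<^sup>2 / (L\<^sup>2 + h * u * v)\<^sup>2) *\<^sub>R q) (at u)"
proof -
  have "((\<lambda>u. (L\<^sup>2 - h * u * v) / (L\<^sup>2 + h * u * v)) has_real_derivative
      - 2 * h * v * L\<^sup>2 / (L\<^sup>2 + h * u * v)\<^sup>2) (at u)"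
    by (rule derivative_eq_intros refl D | simp add: power2_eq_square algebra_simps)+
  moreover have "((\<lambda>u. L\<^sup>2 * u / (L\<^sup>2 + h * u * v)) has_real_derivative
      L^4 / (L\<^sup>2 + h * u * v)\<^sup>2) (at u)"
    by (rule derivative_eq_intros refl D | simp add: power2_eq_square power4_eq_xxxx algebra_simps)+
  moreover have "((\<lambda>u. L\<^sup>2 * v / (L\<^sup>2 + h * u * v)) has_real_derivative
      - h * v\<^sup>2 * L\<^sup>2 / (L\<^sup>2 + h * u * v)\<^sup>2) (at u)"
    by (rule derivative_eq_intros refl D | simp add: power2_eq_square algebra_simps)+
  ultimately show ?thesis
    unfolding world_sheet_frame[OF k] has_real_derivative_iff_has_vector_derivative
    by (intro has_vector_derivative_add
        bounded_linear.has_vector_derivative[OF bounded_linear_scaleR_left])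
qed

lemma area_density_world_sheet:
  assumes V: "V \<odot> V = - L\<^sup>2" and pq: "p \<odot> p = 0" "q \<odot> q = 0" "p \<odot> V = 0" "q \<odot> V = 0"
    and k: "p \<odot> q = - 2 * h"
    and h: "h \<ge> 0" and L: "L > 0" and uv: "u \<ge> 0" "v \<ge> 0"
  shows "sqrt (- det (induced_metric (world_sheet L V p q) u v)) = 2 * h * L^4 / (L\<^sup>2 + h * u * v)\<^sup>2"
proof -
  define D where "D = L\<^sup>2 + h * u * v"
  have Dpos: "D > 0" using h L uv by (auto simp: D_def intro!: add_pos_nonneg)
  define Xm where "Xm = (- 2 * h * v * L\<^sup>2 / D\<^sup>2) *\<^sub>R V + (L^4 / D\<^sup>2) *\<^sub>R p + (- h * v\<^sup>2 * L\<^sup>2 / D\<^sup>2) *\<^sub>R q"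
  define Xp where "Xp = (- 2 * h * u * L\<^sup>2 / D\<^sup>2) *\<^sub>R V + (- h * u\<^sup>2 * L\<^sup>2 / D\<^sup>2) *\<^sub>R p + (L^4 / D\<^sup>2) *\<^sub>R q"
  have k': "q \<odot> p = - 2 * h" using k by (simp add: mdot_commute)
  have "((\<lambda>s. world_sheet L V p q s v) has_vector_derivative Xm) (at u)"
    using has_vector_derivative_world_sheet[OF k, of L u v] Dpos by (simp add: Xm_def D_def)
  hence dm: "vector_derivative (\<lambda>s. world_sheet L V p q s v) (at u) = Xm"
    by (rule vector_derivative_at)
  have "((\<lambda>s. world_sheet L V p q u s) has_vector_derivative Xp) (at v)"
    using has_vector_derivative_world_sheet[OF k', of L v u] Dpos
    unfolding world_sheet_swap[of L V p q]
    by (simp add: Xp_def D_def algebra_simps)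
  hence dp: "vector_derivative (\<lambda>s. world_sheet L V p q u s) (at v) = Xp"
    by (rule vector_derivative_at)
  note frame = mdot_frame[OF V pq k]
  \<comment> \<open>The square of the \<open>V\<close> coefficient and the mixed term in
    \<open>p\<close> and \<open>q\<close> contribute opposite multiples of
    \<open>h\<^sup>2 * v\<^sup>2 * L^6 / D^4\<close>: the parameter lines are null.\<close>
  have mm: "Xm \<odot> Xm = 0"
    unfolding Xm_def frame by (simp add: field_simps power2_eq_square power4_eq_xxxx)
  \<comment> \<open>The numerator is a perfect square. It is written out instead of as
    \<open>D\<^sup>2\<close> so that the expanded terms can be matched.\<close>
  have "Xm \<odot> Xp = - 2 * h * L^4 * (L\<^sup>2 + h * u * v)\<^sup>2 / D^4"
    unfolding Xm_def Xp_def frame using Dpos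
    by (simp add: divide_simps) (simp add: algebra_simps eval_nat_numeral)
  also have "\<dots> = - (2 * h * L^4 / D\<^sup>2)"
    using Dpos unfolding D_def[symmetric] by (simp add: divide_simps power2_eq_square power4_eq_xxxx)
  finally have mp: "Xm \<odot> Xp = - (2 * h * L^4 / D\<^sup>2)" .
  \<comment> \<open>The diagonal of the metric vanishes, so minus the determinant is the square of
    the off-diagonal entry; \<open>h \<ge> 0\<close> then fixes the sign of the root.\<close>
  have "- det (induced_metric (world_sheet L V p q) u v) = (2 * h * L^4 / D\<^sup>2)\<^sup>2"
    by (simp add: induced_metric_def dm dp mm mp det_2 mdot_commute[of Xp Xm] power2_eq_square)
  thus ?thesis
    using h by (simp add: D_def)
qed

lemma lorentzian_area_world_sheet:
  assumes V: "V \<odot> V = - L\<^sup>2" and pq: "p \<odot> p = 0" "q \<odot> q = 0" "p \<odot> V = 0" "q \<odot> V = 0"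
    and k: "p \<odot> q = - 2 * h"
    and h: "h \<ge> 0" and L: "L > 0"
  shows "lorentzian_area (world_sheet L V p q) = 2 * L\<^sup>2 * ln ((L\<^sup>2 + h) / L\<^sup>2)"
proof -
  have pos: "L\<^sup>2 + h * u * v > 0" if "u \<ge> 0" "v \<ge> 0" for u v
    using h L that by (auto intro!: add_pos_nonneg)
  have inner: "integral {0..1} (\<lambda>u. sqrt (- det (induced_metric (world_sheet L V p q) u v)))
      = 2 * h * L\<^sup>2 / (L\<^sup>2 + h * v)" if v: "v \<in> {0..1}" for v
  proof -
    \<comment> \<open>The primitive is normalised to vanish at \<open>u = 0\<close>. The more
      obvious one, a multiple of \<open>1 / (v * (L\<^sup>2 + h * u * v))\<close>, breaks down at
      \<open>v = 0\<close>.\<close>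
    let ?F = "\<lambda>u. 2 * h * L\<^sup>2 * u / (L\<^sup>2 + h * u * v)"
    have "((\<lambda>u. 2 * h * L^4 / (L\<^sup>2 + h * u * v)\<^sup>2) has_integral ?F 1 - ?F 0) {0..1}"
    proof (rule fundamental_theorem_of_calculus)
      fix u :: real assume "u \<in> {0..1}"
      hence D: "L\<^sup>2 + h * u * v \<noteq> 0" using pos[of u v] v by auto
      have "(?F has_real_derivative 2 * h * L^4 / (L\<^sup>2 + h * u * v)\<^sup>2) (at u within {0..1})"
        by (rule derivative_eq_intros refl D
            | simp add: power2_eq_square power4_eq_xxxx algebra_simps)+
      thus "(?F has_vector_derivative 2 * h * L^4 / (L\<^sup>2 + h * u * v)\<^sup>2) (at u within {0..1})"
        by (simp add: has_real_derivative_iff_has_vector_derivative)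
    qed simp
    hence "((\<lambda>u. sqrt (- det (induced_metric (world_sheet L V p q) u v)))
        has_integral ?F 1 - ?F 0) {0..1}"
      by (rule has_integral_eq[rotated])
        (use v area_density_world_sheet[OF V pq k h L] in auto)
    thus ?thesis by (simp add: integral_unique)
  qed
  let ?F = "\<lambda>v. 2 * L\<^sup>2 * ln (L\<^sup>2 + h * v)"
  have "((\<lambda>v. 2 * h * L\<^sup>2 / (L\<^sup>2 + h * v)) has_integral ?F 1 - ?F 0) {0..1}"
  proof (rule fundamental_theorem_of_calculus)
    fix v :: real assume "v \<in> {0..1}"
    hence D: "L\<^sup>2 + h * v > 0" using pos[of 1 v] by auto
    have "(?F has_real_derivative 2 * h * L\<^sup>2 / (L\<^sup>2 + h * v)) (at v within {0..1})"
      by (rule derivative_eq_intros refl D | simp)+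
    thus "(?F has_vector_derivative 2 * h * L\<^sup>2 / (L\<^sup>2 + h * v)) (at v within {0..1})"
      by (simp add: has_real_derivative_iff_has_vector_derivative)
  qed simp
  hence "((\<lambda>v. integral {0..1} (\<lambda>u. sqrt (- det (induced_metric (world_sheet L V p q) u v))))
      has_integral ?F 1 - ?F 0) {0..1}"
    by (rule has_integral_eq[rotated]) (simp add: inner)
  hence "lorentzian_area (world_sheet L V p q) = ?F 1 - ?F 0"
    unfolding lorentzian_area_def by (rule integral_unique)
  thus ?thesis
    using pos[of 1 1] L by (simp add: ln_div algebra_simps)
qed

text \<open>Nullness gives \<open>p^+ p^- = (p^0)^2 - (p^2)^2\<close>, so the square of a boundary
  point is \<open>- L^2 p^+ / p^-\<close>. Together with the cross term, these squares assemble into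
  the ambient product of \<open>p\<close> and \<open>q\<close>.\<close>

lemma bdot_boundary_points:
  assumes "null_vector p" "null_vector q" "minus_comp p \<noteq> 0" "minus_comp q \<noteq> 0"
  shows "bdot (boundary_point L p - boundary_point L q) (boundary_point L p - boundary_point L q)
    = - 2 * L\<^sup>2 * (p \<odot> q) / (minus_comp p * minus_comp q)"
proof -
  define a b c d where "a = p $ 0" "b = p $ 2" "c = q $ 0" "d = q $ 2"
  define m n where "m = minus_comp p" "n = minus_comp q"
  define m' n' where "m' = p $ 1 + p $ (-1)" "n' = q $ 1 + q $ (-1)"
  note defs = a_b_c_d_def m_n_def m'_n'_def
  have p: "m * m' = a\<^sup>2 - b\<^sup>2" and q: "n * n' = c\<^sup>2 - d\<^sup>2"
    using assms(1,2)
    by (auto simp: defs null_vector_def mdot_def minus_comp_def algebra_simps power2_eq_square)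
  have pq: "2 * (p \<odot> q) = m * n' + m' * n - 2 * a * c + 2 * b * d"
    by (simp add: defs mdot_def minus_comp_def algebra_simps)
  have nz: "m \<noteq> 0" "n \<noteq> 0" using assms(3,4) by (auto simp: defs)
  \<comment> \<open>The differences of squares stay grouped so that the null conditions
    \<open>p\<close> and \<open>q\<close> can be substituted for them in the next step.\<close>
  have "bdot (boundary_point L p - boundary_point L q) (boundary_point L p - boundary_point L q)
    = L\<^sup>2 * (- (a\<^sup>2 - b\<^sup>2) * n\<^sup>2 - (c\<^sup>2 - d\<^sup>2) * m\<^sup>2 + 2 * (a * c - b * d) * m * n) / (m\<^sup>2 * n\<^sup>2)"
    using nz unfolding bdot_def boundary_point_def defs[symmetric]
    by (simp add: divide_simps) (simp add: algebra_simps power2_eq_square)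
  also have "\<dots> = - L\<^sup>2 * (2 * (p \<odot> q)) / (m * n)"
    unfolding p[symmetric] q[symmetric] pq using nz
    by (simp add: divide_simps) (simp add: algebra_simps power2_eq_square)
  finally show ?thesis by (simp add: defs)
qed

text \<open>The interval factors in light cone coordinates, so the two logarithms of the entropy
  merge into one.\<close>

lemma entanglement_entropy_eq_ln_bdot:
  assumes "bdot (x - y) (x - y) \<noteq> 0" "\<delta> > 0"
  shows "entanglement_entropy c \<delta> x y = c / 6 * (ln \<bar>bdot (x - y) (x - y)\<bar> - 2 * ln \<delta>)"
proof -
  have b: "bdot (x - y) (x - y) = - ((lc x - lc y) * (lc_bar x - lc_bar y))"
    by (simp add: bdot_def lc_def lc_bar_def algebra_simps)
  hence "lc x - lc y \<noteq> 0" "lc_bar x - lc_bar y \<noteq> 0" using assms by auto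
  thus ?thesis
    using assms(2) unfolding b entanglement_entropy_def abs_minus_cancel abs_mult
    by (simp add: ln_div ln_mult algebra_simps)
qed

text \<open>The products agree in pairs because the null edges close up: squaring
  \<open>p 1 + p 2 = p 3 + p 4\<close> and \<open>p 1 - p 4 = p 3 - p 2\<close> equates them. The
  proof obtains the values by expanding in the frame \<open>V 1\<close>, \<open>p 1\<close>,
  \<open>p 4\<close>.\<close>

lemma string_segment_edge_products:
  assumes seg: "string_segment L V p" and L: "L > 0"
    and k: "p 1 \<odot> p 4 = - 2 * h" and h: "h \<ge> 0"
  shows "null_vector (p 2)" "null_vector (p 3)"
    "p 1 \<odot> p 2 = - 2 * h * L\<^sup>2 / (L\<^sup>2 + h)" "p 3 \<odot> p 4 = - 2 * h * L\<^sup>2 / (L\<^sup>2 + h)"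
    "p 2 \<odot> p 3 = - 2 * h"
proof -
  note s = seg[unfolded string_segment_def null_vector_def AdS3_def]
  have V: "V 1 \<odot> V 1 = - L\<^sup>2" and pq: "p 1 \<odot> p 1 = 0" "p 4 \<odot> p 4 = 0" "p 1 \<odot> V 1 = 0" "p 4 \<odot> V 1 = 0"
    using s by auto
  note frame = mdot_frame[OF V pq k]
  define D where "D = L\<^sup>2 + h"
  have D: "D > 0" using L h by (auto simp: D_def intro!: add_pos_nonneg)
  have V3: "V 3 = ((L\<^sup>2 - h) / D) *\<^sub>R V 1 + (L\<^sup>2 / D) *\<^sub>R p 1 + (L\<^sup>2 / D) *\<^sub>R p 4"
    using s world_sheet_frame[OF k, of L "V 1" 1 1] by (simp add: D_def)
  \<comment> \<open>Splitting off 1 exposes the terms that cancel when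
    \<open>V 2 = V 1 + p 1\<close> or \<open>V 4 = V 1 + p 4\<close> is subtracted from
    \<open>V 3\<close>.\<close>
  have e1: "(L\<^sup>2 - h) / D = 1 - 2 * h / D" and e2: "L\<^sup>2 / D = 1 - h / D"
    using D by (auto simp: divide_simps D_def)
  have p2: "p 2 = (- 2 * h / D) *\<^sub>R V 1 + (- h / D) *\<^sub>R p 1 + (L\<^sup>2 / D) *\<^sub>R p 4"
    using s string_segment_vertices[OF seg L] unfolding V3 e1 e2 by (simp add: algebra_simps)
  have p3: "p 3 = (- 2 * h / D) *\<^sub>R V 1 + (L\<^sup>2 / D) *\<^sub>R p 1 + (- h / D) *\<^sub>R p 4"
    using s string_segment_vertices[OF seg L] unfolding V3 e1 e2 by (simp add: algebra_simps)
  \<comment> \<open>These put the bare edges into the shape that \<open>frame\<close> matches. Each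
    right side contains its left side, so \<open>subst\<close> is applied to one chosen
    occurrence.\<close>
  have p1: "p 1 = 0 *\<^sub>R V 1 + 1 *\<^sub>R p 1 + 0 *\<^sub>R p 4" and p4: "p 4 = 0 *\<^sub>R V 1 + 0 *\<^sub>R p 1 + 1 *\<^sub>R p 4"
    by simp_all
  show "null_vector (p 2)" "null_vector (p 3)"
    unfolding null_vector_def p2 p3 frame by (simp_all add: power2_eq_square)
  show "p 1 \<odot> p 2 = - 2 * h * L\<^sup>2 / (L\<^sup>2 + h)"
    unfolding p2 by (subst p1, subst frame) (simp add: D_def)
  show "p 3 \<odot> p 4 = - 2 * h * L\<^sup>2 / (L\<^sup>2 + h)"
    unfolding p3 by (subst (2) p4, subst frame) (simp add: D_def)
  have "p 2 \<odot> p 3 = - 2 * h * (L\<^sup>2 + h)\<^sup>2 / D\<^sup>2"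
    unfolding p2 p3 frame using D
    by (simp add: divide_simps) (simp add: algebra_simps eval_nat_numeral)
  thus "p 2 \<odot> p 3 = - 2 * h"
    using D by (simp add: D_def)
qed

text \<open>The logarithm is split so that each edge carries its own term in
  \<open>minus_comp\<close>, ready to cancel in the alternating sum. The prefactor is
  \<open>c / 6 = L / (4 * G)\<close>.\<close>

lemma segment_entropy_eq:
  assumes "null_vector (p i)" "null_vector (p j)" "minus_comp (p i) \<noteq> 0" "minus_comp (p j) \<noteq> 0"
    and "L > 0" "\<delta> > 0" "p i \<odot> p j \<noteq> 0"
  shows "segment_entropy L G \<delta> p i j = L / (4 * G) *
    (ln (2 * L\<^sup>2) + ln \<bar>p i \<odot> p j\<bar> - ln \<bar>minus_comp (p i)\<bar> - ln \<bar>minus_comp (p j)\<bar> - 2 * ln \<delta>)"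
proof -
  let ?b = "bdot (boundary_point L (p i) - boundary_point L (p j))
    (boundary_point L (p i) - boundary_point L (p j))"
  note b = bdot_boundary_points[OF assms(1-4), of L]
  have "ln \<bar>?b\<bar> = ln (2 * L\<^sup>2 * \<bar>p i \<odot> p j\<bar> / (\<bar>minus_comp (p i)\<bar> * \<bar>minus_comp (p j)\<bar>))"
    by (simp add: b abs_mult)
  also have "\<dots> = ln (2 * L\<^sup>2) + ln \<bar>p i \<odot> p j\<bar> - ln \<bar>minus_comp (p i)\<bar> - ln \<bar>minus_comp (p j)\<bar>"
    using assms by (simp add: ln_div ln_mult)
  finally have "ln \<bar>?b\<bar> = \<dots>" .
  moreover have "?b \<noteq> 0" using assms by (simp add: b)
  ultimately show ?thesis
    using assms(6)
    by (simp add: segment_entropy_def entanglement_entropy_eq_ln_bdot central_charge_def)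
qed

theorem mainTheorem2:
  fixes L G \<delta> :: real and V p :: "nat \<Rightarrow> real^4"
  assumes "L > 0" and "G > 0" and "\<delta> > 0"
    and "string_segment L V p"
    and "\<forall>i\<in>{1..4}. minus_comp (p i) \<noteq> 0"
    and "causality_conditions L V p"
  shows "segment_area L V p / (4 * G * L) =
    segment_entropy L G \<delta> p 1 4 + segment_entropy L G \<delta> p 2 3
    - segment_entropy L G \<delta> p 3 4 - segment_entropy L G \<delta> p 1 2"
proof -
  define h where "h = - (p 1 \<odot> p 4) / 2"
  have h: "h > 0" using assms(6) by (simp add: h_def causality_conditions_def Let_def)
  have k: "p 1 \<odot> p 4 = - 2 * h" by (simp add: h_def)
  note edges = string_segment_edge_products[OF assms(4,1) k less_imp_le[OF h]]
  have null: "null_vector (p 1)" "null_vector (p 4)"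
    using assms(4) by (auto simp: string_segment_def)
  have nz: "minus_comp (p 1) \<noteq> 0" "minus_comp (p 2) \<noteq> 0" "minus_comp (p 3) \<noteq> 0" "minus_comp (p 4) \<noteq> 0"
    using assms(5) by auto
  have D: "L\<^sup>2 + h > 0" using h by (simp add: add_nonneg_pos)
  have area: "segment_area L V p = 2 * L\<^sup>2 * ln ((L\<^sup>2 + h) / L\<^sup>2)"
    unfolding segment_area_def using assms(4) k h assms(1)
    by (intro lorentzian_area_world_sheet) (auto simp: string_segment_def null_vector_def AdS3_def)
  \<comment> \<open>This is the common value for the pairs 12 and 34; it differs from that of 14 and
    23 by exactly the logarithm in the area.\<close>
  have ln12: "ln \<bar>- 2 * h * L\<^sup>2 / (L\<^sup>2 + h)\<bar> = ln \<bar>- 2 * h\<bar> - ln ((L\<^sup>2 + h) / L\<^sup>2)"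
    using h D assms(1) by (simp add: abs_mult ln_div ln_mult)
  have nz_dot: "- 2 * h \<noteq> 0" "- 2 * h * L\<^sup>2 / (L\<^sup>2 + h) \<noteq> 0" using h D assms(1) by auto
  note S = segment_entropy_eq[OF _ _ _ _ assms(1,3), of p _ _ G]
  have S14: "segment_entropy L G \<delta> p 1 4 = L / (4 * G) * (ln (2 * L\<^sup>2) + ln \<bar>- 2 * h\<bar>
      - ln \<bar>minus_comp (p 1)\<bar> - ln \<bar>minus_comp (p 4)\<bar> - 2 * ln \<delta>)"
    using S[of 1 4] null nz nz_dot unfolding k by blast
  have S23: "segment_entropy L G \<delta> p 2 3 = L / (4 * G) * (ln (2 * L\<^sup>2) + ln \<bar>- 2 * h\<bar>
      - ln \<bar>minus_comp (p 2)\<bar> - ln \<bar>minus_comp (p 3)\<bar> - 2 * ln \<delta>)"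
    using S[of 2 3] edges(1,2) nz nz_dot unfolding edges(5) by blast
  have S34: "segment_entropy L G \<delta> p 3 4 = L / (4 * G) * (ln (2 * L\<^sup>2)
      + (ln \<bar>- 2 * h\<bar> - ln ((L\<^sup>2 + h) / L\<^sup>2))
      - ln \<bar>minus_comp (p 3)\<bar> - ln \<bar>minus_comp (p 4)\<bar> - 2 * ln \<delta>)"
    using S[of 3 4] edges(2) null nz nz_dot unfolding edges(4) ln12 by blast
  have S12: "segment_entropy L G \<delta> p 1 2 = L / (4 * G) * (ln (2 * L\<^sup>2)
      + (ln \<bar>- 2 * h\<bar> - ln ((L\<^sup>2 + h) / L\<^sup>2))
      - ln \<bar>minus_comp (p 1)\<bar> - ln \<bar>minus_comp (p 2)\<bar> - 2 * ln \<delta>)"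
    using S[of 1 2] edges(1) null nz nz_dot unfolding edges(3) ln12 by blast
  have "segment_area L V p / (4 * G * L) = L / (4 * G) * (2 * ln ((L\<^sup>2 + h) / L\<^sup>2))"
    using assms(1) by (simp add: area power2_eq_square)
  \<comment> \<open>Each edge occurs once with each sign, so the \<open>minus_comp\<close> terms
    cancel, as do the cutoff and \<open>ln \<bar>- 2 * h\<bar>\<close>. The pairs 34 and 12 leave
    one copy each of \<open>ln ((L\<^sup>2 + h) / L\<^sup>2)\<close>.\<close>
  also have "\<dots> = segment_entropy L G \<delta> p 1 4 + segment_entropy L G \<delta> p 2 3
      - segment_entropy L G \<delta> p 3 4 - segment_entropy L G \<delta> p 1 2"
    unfolding S14 S23 S34 S12 by algebra
  finally show ?thesis .
qed

end
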